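(* Let $\mathbb{L}$ be a (not necessarily commutative) ring with unity. Let $V$ be a finite set and $n=|V|$. For each $s\in V$, let $x_s\in\mathbb{L}$. Let $X,Y\in\mathbb{L}$ be such that $X+Y+\sum_{s\in V}x_s$ lies in the center of $\mathbb{L}$. Then \[ \sum_{S\subseteq V}X\Big(X+\sum_{s\in S}x_s\Big)^{|S|-1}\Big(Y+\sum_{s\in V\setminus S}x_s\Big)^{n-|S|-1}Y=(X+Y)\Big(X+Y+\sum_{s\in V}x_s\Big)^{n-1}, \] with the following interpretations: the product $X\big(X+\sum_{s\in S}x_s\big)^{|S|-1}$ is interpreted as $1$ when $S=\varnothing$; the product $\big(Y+\sum_{s\in V\setminus S}x_s\big)^{n-|S|-1}Y$ is interpreted as $1$ when $|S|=n$; and the product $(X+Y)\big(X+Y+\sum_{s\in V}x_s\big)^{n-1}$ is interpreted as $1$ when $n=0$. *)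

theory Defs
  imports Main
begin

(* The sort {ring, monoid_mult} describes exactly the associative rings with unity.
   It is used instead of ring_1 because ring_1 (via zero_neq_one) excludes the zero ring. *)

definition ring_center :: "'a::{ring, monoid_mult} set" where
  "ring_center = {z. \<forall>a. z * a = a * z}"

end

theory Submission
  imports Defs
begin

text \<open>
  Let \<open>Z = X + Y + (\<Sum>s\<in>V. x s)\<close>, which is central, and let \<open>A S = X + (\<Sum>s\<in>S. x s)\<close>.
  The second base in the summand of \<open>S\<close> is then \<open>Z - A S\<close>, and it commutes with the first one.
  Let \<open>G V\<close> be the sum of \<open>X (A S)^(|S| - 1) (Z - A S)^(|V| - |S|)\<close> over \<open>S \<subseteq> V\<close>.
  Writing \<open>Y = (Z - A S) - (\<Sum>s\<in>V - S. x s)\<close> splits the left-hand side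
  into \<open>G V - (\<Sum>s\<in>V. G (V - {s}) x s)\<close>, so it is enough that \<open>G V = Z^|V|\<close>.
  Expanding \<open>(Z - A S)^(|V| - |S|)\<close> over the subsets \<open>U\<close> of \<open>V - S\<close>, the coefficient of \<open>Z^|U|\<close>
  with \<open>T = V - U\<close> nonempty is \<open>X\<close> times a \<open>|T|\<close>-th finite difference of the polynomial
  \<open>A^(|T| - 1)\<close>, hence zero.
\<close>

lemma sum_Pow_insert:
  fixes f :: "'s set \<Rightarrow> 'b::comm_monoid_add"
  assumes "finite T" "t \<notin> T"
  shows "(\<Sum>S\<in>Pow (insert t T). f S) = (\<Sum>S\<in>Pow T. f S) + (\<Sum>S\<in>Pow T. f (insert t S))"
proof -
  have inj: "inj_on (insert t) (Pow T)"
    using assms(2) by (auto simp: inj_on_def)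
  have "(\<Sum>S\<in>Pow (insert t T). f S) = (\<Sum>S\<in>Pow T. f S) + (\<Sum>S\<in>insert t ` Pow T. f S)"
    unfolding Pow_insert using assms by (intro sum.union_disjoint) auto
  then show ?thesis
    by (simp add: sum.reindex[OF inj])
qed

text \<open>Double counting of the pairs \<open>t\<close> in \<open>S\<close>: the subsets of
  \<open>T\<close> containing \<open>t\<close> are the sets \<open>insert t S\<close> with
  \<open>S\<close> a subset of \<open>T - {t}\<close>.\<close>

lemma sum_Pow_member:
  fixes f :: "'s \<Rightarrow> 's set \<Rightarrow> 'b::comm_monoid_add"
  assumes "finite T"
  shows "(\<Sum>S\<in>Pow T. \<Sum>t\<in>S. f t S) = (\<Sum>t\<in>T. \<Sum>S\<in>Pow (T - {t}). f t (insert t S))"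
proof -
  have "(\<Sum>S\<in>Pow T. \<Sum>t\<in>S. f t S) = (\<Sum>S\<in>Pow T. \<Sum>t | t \<in> T \<and> t \<in> S. f t S)"
    by (intro sum.cong) auto
  also have "\<dots> = (\<Sum>t\<in>T. \<Sum>S | S \<in> Pow T \<and> t \<in> S. f t S)"
    using assms by (intro sum.swap_restrict) auto
  also have "\<dots> = (\<Sum>t\<in>T. \<Sum>S\<in>Pow (T - {t}). f t (insert t S))"
  proof (rule sum.cong[OF refl])
    fix t assume "t \<in> T"
    then show "(\<Sum>S | S \<in> Pow T \<and> t \<in> S. f t S) = (\<Sum>S\<in>Pow (T - {t}). f t (insert t S))"
      by (intro sum.reindex_bij_witness[where i = "insert t" and j = "\<lambda>S. S - {t}"])
        (auto simp: insert_absorb)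
  qed
  finally show ?thesis .
qed

lemma sign_mult_commute:
  fixes a :: "'a::{ring, monoid_mult}"
  shows "(- 1) ^ k * a = a * (- 1) ^ k"
  by (induction k) (simp_all add: mult.assoc)

lemma minus_power_eq:
  fixes a :: "'a::{ring, monoid_mult}"
  shows "(- a) ^ k = (- 1) ^ k * a ^ k"
proof (induction k)
  case (Suc k)
  then show ?case
    using sign_mult_commute[of k a] by (simp add: mult.assoc[symmetric])
qed simp

text \<open>The binomial theorem indexed by subsets, so that its sum can later be interchanged with
  one over \<open>S\<close>. In the induction, subsets avoiding \<open>w\<close> gain a factor
  \<open>b\<close> and those containing \<open>w\<close> a factor \<open>a\<close>.\<close>

lemma power_card_eq_sum_Pow:
  fixes a b :: "'a::{ring, monoid_mult}"
  assumes "finite W" "a * b = b * a"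
  shows "(a + b) ^ card W = (\<Sum>U\<in>Pow W. a ^ card U * b ^ card (W - U))"
  using assms(1)
proof (induction W)
  case (insert w W)
  have comm: "b * a ^ k = a ^ k * b" for k
    using power_commuting_commutes[of a b k] assms(2) by simp
  have "(\<Sum>U\<in>Pow W. a ^ card U * b ^ card (insert w W - U))
      = (\<Sum>U\<in>Pow W. b * (a ^ card U * b ^ card (W - U)))"
  proof (rule sum.cong[OF refl])
    fix U assume "U \<in> Pow W"
    then have "insert w W - U = insert w (W - U)" "w \<notin> W - U" "finite (W - U)"
      using insert by auto
    then show "a ^ card U * b ^ card (insert w W - U) = b * (a ^ card U * b ^ card (W - U))"
      by (simp add: mult.assoc[symmetric] comm)
  qed
  moreover have "(\<Sum>U\<in>Pow W. a ^ card (insert w U) * b ^ card (insert w W - insert w U))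
      = (\<Sum>U\<in>Pow W. a * (a ^ card U * b ^ card (W - U)))"
  proof (rule sum.cong[OF refl])
    fix U assume "U \<in> Pow W"
    then have "insert w W - insert w U = W - U" "w \<notin> U" "finite U"
      using insert by (auto intro: finite_subset)
    then show "a ^ card (insert w U) * b ^ card (insert w W - insert w U)
        = a * (a ^ card U * b ^ card (W - U))"
      by (simp add: mult.assoc)
  qed
  ultimately show ?case
    using insert by (simp add: sum_Pow_insert distrib_right sum_distrib_left sum.distrib add.commute)
qed simp

text \<open>Induction on \<open>m\<close>: one factor \<open>X + (sum of x s)\<close> is split off
  on the left. Its \<open>X\<close> part leaves the same difference for \<open>m\<close>; its
  \<open>x s\<close> part leaves, after interchanging the sums, a difference over
  \<open>T - {s}\<close>. No commutation is used except that of the signs.\<close>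

lemma finite_difference_power_eq_0:
  fixes x :: "'s \<Rightarrow> 'a::{ring, monoid_mult}" and X :: 'a
  assumes "finite T" "m < card T"
  shows "(\<Sum>S\<in>Pow T. (- 1) ^ card (T - S) * (X + (\<Sum>s\<in>S. x s)) ^ m) = 0"
  using assms
proof (induction m arbitrary: T X)
  case 0
  then obtain k where "card T = Suc k"
    using gr0_implies_Suc by blast
  \<comment> \<open>The sum is the expansion of \<open>(1 + (- 1)) ^ card T\<close>, with positive
    exponent.\<close>
  then show ?case
    using power_card_eq_sum_Pow[of T "1::'a" "- 1"] \<open>finite T\<close> by simp
next
  case (Suc m)
  define sg :: "'s set \<Rightarrow> 'a" where "sg S = (- 1) ^ card (T - S)" for S
  define A where "A S = X + (\<Sum>s\<in>S. x s)" for S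
  have comm: "sg S * a = a * sg S" for S a
    unfolding sg_def by (rule sign_mult_commute)
  have "(\<Sum>S\<in>Pow T. sg S * A S ^ Suc m)
      = (\<Sum>S\<in>Pow T. X * (sg S * A S ^ m) + (\<Sum>s\<in>S. x s * (sg S * A S ^ m)))"
  proof (rule sum.cong[OF refl])
    fix S
    have "sg S * A S ^ Suc m = A S * (sg S * A S ^ m)"
      by (metis comm mult.assoc power_Suc)
    then show "sg S * A S ^ Suc m = X * (sg S * A S ^ m) + (\<Sum>s\<in>S. x s * (sg S * A S ^ m))"
      by (simp add: A_def distrib_right sum_distrib_right)
  qed
  also have "\<dots> = X * (\<Sum>S\<in>Pow T. sg S * A S ^ m)
      + (\<Sum>S\<in>Pow T. \<Sum>s\<in>S. x s * (sg S * A S ^ m))"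
    by (simp add: sum.distrib sum_distrib_left)
  also have "(\<Sum>S\<in>Pow T. sg S * A S ^ m) = 0"
    unfolding sg_def A_def using Suc by simp
  also have "(\<Sum>S\<in>Pow T. \<Sum>s\<in>S. x s * (sg S * A S ^ m))
      = (\<Sum>s\<in>T. x s * (\<Sum>S\<in>Pow (T - {s}). sg (insert s S) * A (insert s S) ^ m))"
    by (simp add: sum_Pow_member Suc.prems(1) sum_distrib_left)
  also have "\<dots> = (\<Sum>s\<in>T. x s * 0)"
  proof (intro sum.cong refl arg_cong2[where f = "(*)"])
    fix s assume s: "s \<in> T"
    \<comment> \<open>The fixed element \<open>s\<close> is absorbed into the constant term, now
      \<open>X + x s\<close>; hence \<open>X\<close> is arbitrary in the induction. The set
      \<open>T - {s}\<close> still has more than \<open>m\<close> elements.\<close>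
    have "(\<Sum>S\<in>Pow (T - {s}). sg (insert s S) * A (insert s S) ^ m)
        = (\<Sum>S\<in>Pow (T - {s}). (- 1) ^ card ((T - {s}) - S) * ((X + x s) + (\<Sum>s\<in>S. x s)) ^ m)"
    proof (rule sum.cong[OF refl])
      fix S assume S: "S \<in> Pow (T - {s})"
      then have "finite S" "s \<notin> S"
        using Suc.prems(1) by (auto intro: finite_subset)
      moreover have "T - insert s S = (T - {s}) - S" by auto
      ultimately show "sg (insert s S) * A (insert s S) ^ m
          = (- 1) ^ card ((T - {s}) - S) * ((X + x s) + (\<Sum>s\<in>S. x s)) ^ m"
        by (simp add: sg_def A_def add.assoc)
    qed
    also have "\<dots> = 0"
      using Suc.prems s by (intro Suc.IH) auto
    finally show "(\<Sum>S\<in>Pow (T - {s}). sg (insert s S) * A (insert s S) ^ m) = 0" .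
  qed
  finally show ?case
    by (simp add: sg_def A_def)
qed

text \<open>Here \<open>Z\<close> is a free central element instead of an expression in
  \<open>Y\<close> and \<open>V\<close>, so that the identity applies to \<open>V\<close> and to
  each \<open>V - {s}\<close> with the same \<open>Z\<close>.\<close>

lemma Abel_Hurwitz_central:
  fixes x :: "'s \<Rightarrow> 'a::{ring, monoid_mult}" and X Z :: 'a
  assumes "finite V" and Z: "Z \<in> ring_center"
  shows "(\<Sum>S\<in>Pow V. (if S = {} then 1 else X * (X + (\<Sum>s\<in>S. x s)) ^ (card S - 1))
            * (Z - (X + (\<Sum>s\<in>S. x s))) ^ card (V - S)) = Z ^ card V"
proof -
  define A where "A S = X + (\<Sum>s\<in>S. x s)" for S
  define p where "p S = (if S = {} then 1 else X * A S ^ (card S - 1))" for S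
  have Zcomm: "a * Z ^ k = Z ^ k * a" for a k
    using Z power_commuting_commutes[of Z a k] by (simp add: ring_center_def)
  have Zleft: "a * (Z ^ k * b) = Z ^ k * (a * b)" for a b k
    by (metis Zcomm mult.assoc)
  have coeff: "(\<Sum>S\<in>Pow T. p S * (- A S) ^ card (T - S)) = 0" if T: "T \<subseteq> V" "T \<noteq> {}" for T
  proof -
    have fin: "finite T" using T(1) assms(1) by (rule finite_subset)
    have "(\<Sum>S\<in>Pow T. p S * (- A S) ^ card (T - S))
        = (\<Sum>S\<in>Pow T. X * ((- 1) ^ card (T - S) * A S ^ (card T - 1)))"
    proof (rule sum.cong[OF refl])
      fix S assume S: "S \<in> Pow T"
      \<comment> \<open>The total exponent does not depend on \<open>S\<close>. The empty set fits
        in because \<open>A {} = X\<close> and \<open>T\<close> is nonempty: the default value 1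
        times \<open>X ^ card T\<close> is \<open>X * X ^ (card T - 1)\<close>.\<close>
      have "p S * A S ^ card (T - S) = X * A S ^ (card T - 1)"
      proof (cases "S = {}")
        case True
        then show ?thesis
          using fin T(2) by (cases "card T") (auto simp: p_def A_def)
      next
        case False
        have finS: "finite S" using S fin by (auto intro: finite_subset)
        then have "card S - 1 + card (T - S) = card T - 1"
          using S fin False card_mono[of T S] by (simp add: card_Diff_subset card_gt_0_iff Suc_le_eq)
        then show ?thesis
          using False by (simp add: p_def mult.assoc flip: power_add)
      qed
      then show "p S * (- A S) ^ card (T - S) = X * ((- 1) ^ card (T - S) * A S ^ (card T - 1))"
        by (metis minus_power_eq[of "A S"] sign_mult_commute mult.assoc)
    qed
    also have "\<dots> = X * (\<Sum>S\<in>Pow T. (- 1) ^ card (T - S) * A S ^ (card T - 1))"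
      by (simp add: sum_distrib_left)
    also have "\<dots> = 0"
      unfolding A_def using fin T(2) by (subst finite_difference_power_eq_0) (auto simp: card_gt_0_iff)
    finally show ?thesis .
  qed
  have "(\<Sum>S\<in>Pow V. p S * (Z - A S) ^ card (V - S))
      = (\<Sum>S\<in>Pow V. \<Sum>U | U \<in> Pow V \<and> S \<subseteq> V - U. Z ^ card U * (p S * (- A S) ^ card (V - U - S)))"
  proof (rule sum.cong[OF refl])
    fix S assume S: "S \<in> Pow V"
    have "(Z - A S) ^ card (V - S) = (\<Sum>U\<in>Pow (V - S). Z ^ card U * (- A S) ^ card (V - S - U))"
      using power_card_eq_sum_Pow[of "V - S" Z "- A S"] Zcomm[of "A S" 1] assms(1) by simp
    then have "p S * (Z - A S) ^ card (V - S)
        = (\<Sum>U\<in>Pow (V - S). Z ^ card U * (p S * (- A S) ^ card (V - S - U)))"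
      by (simp add: sum_distrib_left Zleft)
    moreover have "Pow (V - S) = {U \<in> Pow V. S \<subseteq> V - U}"
      using S by auto
    moreover have "V - S - U = V - U - S" for U by auto
    ultimately show "p S * (Z - A S) ^ card (V - S)
        = (\<Sum>U | U \<in> Pow V \<and> S \<subseteq> V - U. Z ^ card U * (p S * (- A S) ^ card (V - U - S)))"
      by simp
  qed
  also have "\<dots> = (\<Sum>U\<in>Pow V. \<Sum>S | S \<in> Pow V \<and> S \<subseteq> V - U.
      Z ^ card U * (p S * (- A S) ^ card (V - U - S)))"
    using assms(1) by (intro sum.swap_restrict) auto
  also have "\<dots> = (\<Sum>U\<in>Pow V. Z ^ card U * (\<Sum>S\<in>Pow (V - U). p S * (- A S) ^ card (V - U - S)))"
    by (auto simp: sum_distrib_left intro!: sum.cong)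
  \<comment> \<open>For \<open>U = V\<close> only \<open>S = {}\<close> remains, and its coefficient
    is the default value 1.\<close>
  also have "\<dots> = (\<Sum>U\<in>Pow V. if U = V then Z ^ card V else 0)"
  proof (rule sum.cong[OF refl])
    fix U assume "U \<in> Pow V"
    then show "Z ^ card U * (\<Sum>S\<in>Pow (V - U). p S * (- A S) ^ card (V - U - S))
        = (if U = V then Z ^ card V else 0)"
      using coeff[of "V - U"] by (auto simp: p_def)
  qed
  also have "\<dots> = Z ^ card V"
    using assms(1) by (simp add: sum.delta)
  finally show ?thesis
    unfolding p_def A_def .
qed

theorem theorem2p7:
  fixes V :: "'s set" and n :: nat
    and x :: "'s \<Rightarrow> 'a::{ring, monoid_mult}" and X Y :: 'a
  assumes "finite V" and "n = card V"
    and "X + Y + (\<Sum>s\<in>V. x s) \<in> ring_center"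
  shows "(\<Sum>S\<in>Pow V.
            (if S = {} then 1 else X * (X + (\<Sum>s\<in>S. x s)) ^ (card S - 1))
          * (if card S = n then 1 else (Y + (\<Sum>s\<in>V - S. x s)) ^ (n - card S - 1) * Y))
       = (if n = 0 then 1 else (X + Y) * (X + Y + (\<Sum>s\<in>V. x s)) ^ (n - 1))"
proof -
  define A where "A S = X + (\<Sum>s\<in>S. x s)" for S
  define Z where "Z = X + Y + (\<Sum>s\<in>V. x s)"
  define p where "p S = (if S = {} then 1 else X * A S ^ (card S - 1))" for S
  have Z: "Z \<in> ring_center"
    using assms(3) by (simp add: Z_def)
  then have Zcomm: "a * Z ^ k = Z ^ k * a" for a k
    using power_commuting_commutes[of Z a k] by (simp add: ring_center_def)
  have G: "(\<Sum>S\<in>Pow W. p S * (Z - A S) ^ card (W - S)) = Z ^ card W" if "finite W" for W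
    unfolding p_def A_def using that Z by (rule Abel_Hurwitz_central)
  have "(\<Sum>S\<in>Pow V. p S *
          (if card S = n then 1 else (Y + (\<Sum>s\<in>V - S. x s)) ^ (n - card S - 1) * Y))
      = (\<Sum>S\<in>Pow V. p S * (Z - A S) ^ card (V - S)
          - (\<Sum>s | s \<in> V \<and> s \<notin> S. p S * (Z - A S) ^ card (V - {s} - S) * x s))"
  proof (rule sum.cong[OF refl])
    fix S assume S: "S \<in> Pow V"
    then have finS: "finite S" using assms(1) by (auto intro: finite_subset)
    have split: "(\<Sum>s\<in>V. x s) = (\<Sum>s\<in>S. x s) + (\<Sum>s\<in>V - S. x s)"
      using S assms(1) by (simp add: sum.subset_diff add.commute)
    have base: "Y + (\<Sum>s\<in>V - S. x s) = Z - A S"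
      by (simp add: Z_def A_def split algebra_simps)
    have cardD: "card (V - S) = n - card S"
      using S finS assms(2) by (simp add: card_Diff_subset)
    \<comment> \<open>Splitting \<open>Y\<close> as the rightmost factor puts each
      \<open>x s\<close> on the right. For \<open>S = V\<close> the default value 1 agrees with the
      zeroth power minus an empty sum.\<close>
    have factor: "(if card S = n then 1 else (Y + (\<Sum>s\<in>V - S. x s)) ^ (n - card S - 1) * Y)
        = (Z - A S) ^ card (V - S) - (\<Sum>s\<in>V - S. (Z - A S) ^ card (V - {s} - S) * x s)"
    proof (cases "S = V")
      case True
      then show ?thesis using assms(2) by simp
    next
      case False
      then have "card S < n"
        using S assms(1,2) by (auto intro: psubset_card_mono)
      then obtain k where k: "card (V - S) = Suc k"
        using cardD by (metis zero_less_diff gr0_implies_Suc)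
      have "(\<Sum>s\<in>V - S. (Z - A S) ^ card (V - {s} - S) * x s) = (Z - A S) ^ k * (\<Sum>s\<in>V - S. x s)"
        unfolding sum_distrib_left
      proof (rule sum.cong[OF refl])
        fix s assume s: "s \<in> V - S"
        have "V - {s} - S = (V - S) - {s}" by auto
        then have "card (V - {s} - S) = k"
          using s k assms(1) by simp
        then show "(Z - A S) ^ card (V - {s} - S) * x s = (Z - A S) ^ k * x s" by simp
      qed
      moreover have "Y = (Z - A S) - (\<Sum>s\<in>V - S. x s)"
        by (simp flip: base)
      then have "(Z - A S) ^ k * Y = (Z - A S) ^ Suc k - (Z - A S) ^ k * (\<Sum>s\<in>V - S. x s)"
        by (metis power_Suc2 right_diff_distrib)
      ultimately show ?thesis
        using \<open>card S < n\<close> k cardD by (simp only: base) simp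
    qed
    show "p S * (if card S = n then 1 else (Y + (\<Sum>s\<in>V - S. x s)) ^ (n - card S - 1) * Y)
        = p S * (Z - A S) ^ card (V - S)
          - (\<Sum>s | s \<in> V \<and> s \<notin> S. p S * (Z - A S) ^ card (V - {s} - S) * x s)"
      unfolding factor by (simp add: right_diff_distrib sum_distrib_left mult.assoc set_diff_eq)
  qed
  also have "\<dots> = Z ^ n
      - (\<Sum>S\<in>Pow V. \<Sum>s | s \<in> V \<and> s \<notin> S. p S * (Z - A S) ^ card (V - {s} - S) * x s)"
    using G[OF assms(1)] assms(2) by (simp add: sum_subtractf)
  also have "(\<Sum>S\<in>Pow V. \<Sum>s | s \<in> V \<and> s \<notin> S. p S * (Z - A S) ^ card (V - {s} - S) * x s)
      = (\<Sum>s\<in>V. \<Sum>S | S \<in> Pow V \<and> s \<notin> S. p S * (Z - A S) ^ card (V - {s} - S) * x s)"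
    using assms(1) by (intro sum.swap_restrict) auto
  \<comment> \<open>With \<open>x s\<close> factored out on the right, the inner sum is the identity
    \<open>G\<close> for \<open>V - {s}\<close>.\<close>
  also have "\<dots> = (\<Sum>s\<in>V. Z ^ (n - 1) * x s)"
  proof (rule sum.cong[OF refl])
    fix s assume s: "s \<in> V"
    have "{S \<in> Pow V. s \<notin> S} = Pow (V - {s})" by auto
    then show "(\<Sum>S | S \<in> Pow V \<and> s \<notin> S. p S * (Z - A S) ^ card (V - {s} - S) * x s)
        = Z ^ (n - 1) * x s"
      using G[of "V - {s}"] assms(1,2) s by (simp flip: sum_distrib_right)
  qed
  also have "Z ^ n - (\<Sum>s\<in>V. Z ^ (n - 1) * x s) = (if n = 0 then 1 else (X + Y) * Z ^ (n - 1))"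
  proof (cases n)
    case 0
    then show ?thesis using assms(1,2) by simp
  next
    case (Suc k)
    \<comment> \<open>Centrality of \<open>Z\<close> moves its power from the left of the
      \<open>x s\<close> to the right, where the stated form has it.\<close>
    have "X + Y = Z - (\<Sum>s\<in>V. x s)" by (simp add: Z_def)
    then show ?thesis
      using Zcomm[of "\<Sum>s\<in>V. x s" k]
      by (simp add: Suc left_diff_distrib flip: sum_distrib_left)
  qed
  finally show ?thesis
    by (simp only: p_def A_def Z_def)
qed

end
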